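(* Let $k\ge 0$ be an integer. If $G$ is a circle $k$-visibility graph, then its chromatic number satisfies $\chi(G)\le 6k+6$.
   Context: All circles and arcs are centered at the origin of the plane. An arc is a set given in polar coordinates by $\{(r,\alpha):\alpha_1\le\alpha\le\alpha_2\}$ with $r>0$, $\alpha_1\in[0,2\pi)$ and $0\le\alpha_2-\alpha_1<2\pi$. A (non-degenerate) cone is a 4-sided region of positive area with two opposite sides being arcs of circles centered at the origin and the other two sides being (possibly intersecting) radial line segments. So a cone is either a region $\{(r,\alpha): r_1\le r\le r_2,\ \theta_1\le\alpha\le\theta_2\}$ or a "bow-tie" region through the origin, $\{(r,\alpha):0\le r\le r_1,\ \theta_1\le\alpha\le\theta_2\}\cup\{(r,\alpha):0\le r\le r_2,\ \theta_1+\pi\le\alpha\le\theta_2+\pi\}$; in particular, visibility through the origin is allowed. The two circular sides are called the circular ends of the cone. A circle $k$-visibility graph is a finite graph whose vertices can be represented by pairwise disjoint objects, each of which is an arc or a full circle centered at the origin, such that two distinct vertices are adjacent if and only if there is a cone whose two circular ends are subsets of the two corresponding objects, one in each, and which intersects at most $k$ objects of the representation other than these two. *)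

theory Defs
  imports Complex_Main "Graph_Theory.Digraph"
begin

text \<open>The plane is the complex plane; \<open>rcis r t\<close> is the point with polar coordinates \<open>(r, t)\<close>.\<close>

definition circular_arc :: "real \<Rightarrow> real \<Rightarrow> real \<Rightarrow> complex set" where
  "circular_arc r a b = {rcis r t | t. a \<le> t \<and> t \<le> b}"

definition is_arc :: "complex set \<Rightarrow> bool" where
  "is_arc A \<longleftrightarrow> (\<exists>r a b. r > 0 \<and> 0 \<le> a \<and> a < 2 * pi \<and> 0 \<le> b - a \<and> b - a < 2 * pi
                        \<and> A = circular_arc r a b)"

definition is_circle :: "complex set \<Rightarrow> bool" where
  "is_circle A \<longleftrightarrow> (\<exists>r>0. A = {z. cmod z = r})"

definition polar_region :: "real \<Rightarrow> real \<Rightarrow> real \<Rightarrow> real \<Rightarrow> complex set" where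
  "polar_region r s a b = {rcis q t | q t. r \<le> q \<and> q \<le> s \<and> a \<le> t \<and> t \<le> b}"

text \<open>\<open>cone C A B\<close>: \<open>C\<close> is a non-degenerate cone with circular ends \<open>A\<close> and \<open>B\<close>.
  The bounds on \<open>b - a\<close> say that \<open>C\<close> really has four sides: an angle of \<open>2 * pi\<close> would give a
  full annulus, and for an angle of at least \<open>pi\<close> the two halves of a bow-tie would overlap in
  more than the origin.\<close>

inductive cone :: "complex set \<Rightarrow> complex set \<Rightarrow> complex set \<Rightarrow> bool" where
  annular: "\<lbrakk>0 < r; r < s; a < b; b - a < 2 * pi\<rbrakk>
    \<Longrightarrow> cone (polar_region r s a b) (circular_arc r a b) (circular_arc s a b)"
| bow_tie: "\<lbrakk>0 < r; 0 < s; a < b; b - a < pi\<rbrakk>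
    \<Longrightarrow> cone (polar_region 0 r a b \<union> polar_region 0 s (a + pi) (b + pi))
             (circular_arc r a b) (circular_arc s (a + pi) (b + pi))"

text \<open>The object representing the vertex \<open>v\<close> is \<open>f v\<close>. In a representation the objects are
  nonempty and pairwise disjoint, so that counting vertices is the same as counting objects.\<close>

definition k_visible :: "nat \<Rightarrow> 'a set \<Rightarrow> ('a \<Rightarrow> complex set) \<Rightarrow> 'a \<Rightarrow> 'a \<Rightarrow> bool" where
  "k_visible k V f u v \<longleftrightarrow>
     (\<exists>C A B. cone C A B \<and> (A \<subseteq> f u \<and> B \<subseteq> f v \<or> A \<subseteq> f v \<and> B \<subseteq> f u)
            \<and> card {w \<in> V - {u, v}. C \<inter> f w \<noteq> {}} \<le> k)"

definition circle_representation ::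
    "nat \<Rightarrow> ('a, 'b) pre_digraph \<Rightarrow> ('a \<Rightarrow> complex set) \<Rightarrow> bool" where
  "circle_representation k G f \<longleftrightarrow>
     (\<forall>v\<in>verts G. is_arc (f v) \<or> is_circle (f v))
     \<and> pairwise (\<lambda>u v. disjnt (f u) (f v)) (verts G)
     \<and> (\<forall>u\<in>verts G. \<forall>v\<in>verts G. u \<noteq> v \<longrightarrow> (u \<rightarrow>\<^bsub>G\<^esub> v \<longleftrightarrow> k_visible k (verts G) f u v))"

text \<open>The locale \<^locale>\<open>graph\<close> describes finite simple graphs, as finite symmetric digraphs
  without loops and multiple arcs.\<close>

definition circle_visibility_graph :: "nat \<Rightarrow> ('a, 'b) pre_digraph \<Rightarrow> bool" where
  "circle_visibility_graph k G \<longleftrightarrow> graph G \<and> (\<exists>f. circle_representation k G f)"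

definition proper_coloring :: "('a, 'b) pre_digraph \<Rightarrow> nat \<Rightarrow> ('a \<Rightarrow> nat) \<Rightarrow> bool" where
  "proper_coloring G n c \<longleftrightarrow>
     (\<forall>v\<in>verts G. c v < n) \<and> (\<forall>u\<in>verts G. \<forall>v\<in>verts G. u \<rightarrow>\<^bsub>G\<^esub> v \<longrightarrow> c u \<noteq> c v)"

definition chromatic_number :: "('a, 'b) pre_digraph \<Rightarrow> nat" where
  "chromatic_number G = (LEAST n. \<exists>c. proper_coloring G n c)"

text \<open>The minimum is attained for every finite simple graph.\<close>

lemma (in graph) ex_proper_coloring_chromatic_number:
  "\<exists>c. proper_coloring G (chromatic_number G) c"
proof -
  obtain c where c: "bij_betw c (verts G) {0..<card (verts G)}"
    using ex_bij_betw_finite_nat[OF finite_verts] by blast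
  have "proper_coloring G (card (verts G)) c"
    unfolding proper_coloring_def
  proof (intro conjI ballI impI)
    fix v assume "v \<in> verts G"
    then show "c v < card (verts G)"
      using bij_betwE[OF c] by auto
  next
    fix u v assume "u \<in> verts G" "v \<in> verts G" "u \<rightarrow>\<^bsub>G\<^esub> v"
    then show "c u \<noteq> c v"
      using adj_not_same inj_onD[OF bij_betw_imp_inj_on[OF c], of u v] by auto
  qed
  then have "\<exists>c. proper_coloring G (card (verts G)) c" by (rule exI[of _ c])
  then show ?thesis
    unfolding chromatic_number_def by (rule LeastI)
qed

end

theory Submission
  imports Defs
begin

text \<open>The graph on \<open>n > 0\<close> objects has fewer than \<open>(3 * k + 3) * n\<close> edges, hence a vertex of
  degree less than \<open>6 * k + 6\<close>. Deleting an object keeps all visibilities between the others,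
  so a greedy colouring needs only \<open>6 * k + 6\<close> colours.

  For the edge count, rotate a line through the origin by a full turn. An edge is realised on a
  single ray if possible, and through the origin otherwise. The rotation makes it appear either
  because one of its two objects starts, or because a blocking object ends. A starting object
  yields at most \<open>k + 1\<close> new edges outwards and \<open>k + 1\<close> inwards, an ending one at most
  \<open>k + 1\<close>. An edge that never disappears joins two full circles on a ray, and is charged to the
  inner one. The outermost object has no outward edges, which makes the bound strict.\<close>

section \<open>Visibility along a single line through the origin\<close>

text \<open>A line through the origin carries the objects \<open>A\<close> on its positive ray and \<open>B\<close> on its
  negative ray; a point of it is given by its signed distance from the origin.\<close>

definition occurs :: "('a \<Rightarrow> real) \<Rightarrow> 'a set \<Rightarrow> 'a set \<Rightarrow> 'a \<Rightarrow> real \<Rightarrow> bool" where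
  "occurs r A B w x \<longleftrightarrow> (w \<in> A \<and> x = r w) \<or> (w \<in> B \<and> x = - r w)"

text \<open>Objects are collected, not crossing points: an object that meets the segment on both
  rays counts once, as it does in \<open>k_visible\<close>.\<close>

definition between :: "('a \<Rightarrow> real) \<Rightarrow> 'a set \<Rightarrow> 'a set \<Rightarrow> real \<Rightarrow> real \<Rightarrow> 'a set" where
  "between r A B x y = {w. \<exists>z. x < z \<and> z < y \<and> occurs r A B w z}"

definition sees :: "nat \<Rightarrow> ('a \<Rightarrow> real) \<Rightarrow> 'a set \<Rightarrow> 'a set \<Rightarrow> 'a \<Rightarrow> real \<Rightarrow> 'a \<Rightarrow> real \<Rightarrow> bool" where
  "sees k r A B u x v y \<longleftrightarrow> u \<noteq> v \<and> x < y \<and> occurs r A B u x \<and> occurs r A B v y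
     \<and> card (between r A B x y - {u, v}) \<le> k"

text \<open>A half-turn of the line exchanges the two rays and negates signed distances. This
  symmetry carries statements about right-hand ends over to left-hand ends.\<close>

lemma occurs_flip: "occurs r B A w (- x) \<longleftrightarrow> occurs r A B w x"
  by (auto simp: occurs_def)

lemma between_flip: "between r B A (- y) (- x) = between r A B x y"
proof -
  have "between r A B x y \<subseteq> between r B A (- y) (- x)" for A B x y
  proof
    fix w assume "w \<in> between r A B x y"
    then obtain z where "x < z" "z < y" "occurs r A B w z"
      by (auto simp: between_def)
    then show "w \<in> between r B A (- y) (- x)"
      unfolding between_def by (auto simp: occurs_flip intro!: exI[of _ "- z"])
  qed
  from this[of A B x y] this[of B A "- y" "- x"] show ?thesis by auto
qed

lemma sees_flip: "sees k r B A v (- y) u (- x) \<longleftrightarrow> sees k r A B u x v y"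
  unfolding sees_def by (auto simp: occurs_flip between_flip insert_commute)

lemma between_subset: "between r A B x y \<subseteq> A \<union> B"
  by (auto simp: between_def occurs_def)

lemma finite_between: "finite A \<Longrightarrow> finite B \<Longrightarrow> finite (between r A B x y)"
  using between_subset[of r A B x y] finite_subset by blast

lemma between_mono:
  "A \<subseteq> A' \<Longrightarrow> B \<subseteq> B' \<Longrightarrow> x' \<le> x \<Longrightarrow> y \<le> y' \<Longrightarrow> between r A B x y \<subseteq> between r A' B' x' y'"
  unfolding between_def occurs_def by (safe; force)

text \<open>Positive radii keep the two rays apart, and on each ray the radius determines the
  object.\<close>

lemma occurs_unique:
  assumes "inj_on r A" "inj_on r B" "\<And>w. w \<in> A \<union> B \<Longrightarrow> 0 < r w"
    and "occurs r A B u x" "occurs r A B v x"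
  shows "u = v"
  using assms unfolding occurs_def inj_on_def
  by (smt (verit) Un_iff)

text \<open>All objects seen from \<open>x\<close> except the farthest lie inside the segment to the
  farthest, which has room for at most \<open>k\<close> of them.\<close>

lemma card_seen_right:
  assumes "finite A" "finite B" "inj_on r A" "inj_on r B" "\<And>w. w \<in> A \<union> B \<Longrightarrow> 0 < r w"
  shows "card {v. \<exists>y. sees k r A B u x v y} \<le> k + 1"
proof -
  define N where "N = {v. \<exists>y. sees k r A B u x v y}"
  have "N \<subseteq> A \<union> B" by (auto simp: N_def sees_def occurs_def)
  then have fin: "finite N" using assms(1,2) finite_subset by blast
  \<comment> \<open>An object may be seen at two points, one on each ray; one of them is
    chosen.\<close>
  obtain y where y: "\<And>v. v \<in> N \<Longrightarrow> sees k r A B u x v (y v)"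
    unfolding N_def by atomize_elim (auto intro: choice)
  have "card N \<le> k + 1"
  proof (cases "N = {}")
    case False
    obtain v where v: "v \<in> N" "\<And>w. w \<in> N \<Longrightarrow> y w \<le> y v"
        using arg_min_if_finite[OF fin False, of "\<lambda>v. - y v"] by (auto simp: not_less)
    have "N - {v} \<subseteq> between r A B x (y v) - {u, v}"
    proof
      fix w assume w: "w \<in> N - {v}"
      then have "y w \<noteq> y v"
        using occurs_unique[OF assms(3-5), of w "y w" v] y[of w] y[OF v(1)]
        by (auto simp: sees_def)
      then have "y w < y v" using v(2)[of w] w by auto
      then show "w \<in> between r A B x (y v) - {u, v}"
        using y[of w] w by (auto simp: between_def sees_def)
    qed
    then have "card (N - {v}) \<le> card (between r A B x (y v) - {u, v})"
      by (intro card_mono finite_Diff finite_between assms)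
    also have "\<dots> \<le> k" using y[OF v(1)] by (simp add: sees_def)
    finally show ?thesis using v(1) fin by simp
  qed simp
  then show ?thesis by (simp add: N_def)
qed

lemma card_seen_left:
  assumes "finite A" "finite B" "inj_on r A" "inj_on r B" "\<And>w. w \<in> A \<union> B \<Longrightarrow> 0 < r w"
  shows "card {u. \<exists>x. sees k r A B u x v y} \<le> k + 1"
proof -
  have "{u. \<exists>x. sees k r A B u x v y} = {u. \<exists>x. sees k r B A v (- y) u x}"
    using sees_flip[of k r B A v y] by (metis minus_minus)
  then show ?thesis
    using card_seen_right[OF assms(2,1,4,3), of k v "- y"] assms(5) by (simp add: Un_commute)
qed

text \<open>The pair has exactly one blocker too many, and \<open>b\<close> is one of its blockers.
  Neither end recurs inside the segment; this is what lets \<open>card_blocks\<close> tell pairs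
  apart by their left ends.\<close>

definition blocks :: "nat \<Rightarrow> ('a \<Rightarrow> real) \<Rightarrow> 'a set \<Rightarrow> 'a set \<Rightarrow> 'a \<Rightarrow> real \<Rightarrow> 'a \<Rightarrow> 'a \<Rightarrow> bool" where
  "blocks k r A B b z u v \<longleftrightarrow> (\<exists>x y. x < z \<and> z < y \<and> occurs r A B b z \<and> u \<noteq> v
     \<and> occurs r A B u x \<and> occurs r A B v y
     \<and> u \<notin> between r A B x y \<and> v \<notin> between r A B x y \<and> card (between r A B x y) = k + 1)"

lemma blocks_mem: "blocks k r A B b z u v \<Longrightarrow> u \<in> A \<union> B \<and> v \<in> A \<union> B"
  by (auto simp: blocks_def occurs_def)

lemma blocks_flip: "blocks k r B A b (- z) v u \<longleftrightarrow> blocks k r A B b z u v"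
proof -
  have "blocks k r B A b (- z) v u" if "blocks k r A B b z u v" for A B z u v
  proof -
    from that obtain x y where *: "x < z" "z < y" "occurs r A B b z" "u \<noteq> v" "occurs r A B u x"
      "occurs r A B v y" "u \<notin> between r A B x y" "v \<notin> between r A B x y"
      "card (between r A B x y) = k + 1"
      by (auto simp: blocks_def)
    then show ?thesis
      unfolding blocks_def
      by (intro exI[of _ "- y"] exI[of _ "- x"]) (simp add: occurs_flip between_flip)
  qed
  from this[of A B z u v] this[of B A "- z" v u] show ?thesis by auto
qed

text \<open>A blocked pair is determined by its left endpoint, and the left endpoints of the other
  blocked pairs lie inside the longest of the blocked segments, all of them on one side of \<open>z\<close>.\<close>

lemma card_blocks:
  assumes fin: "finite A" "finite B" and inj: "inj_on r A" "inj_on r B"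
    and pos: "\<And>w. w \<in> A \<union> B \<Longrightarrow> 0 < r w"
  shows "card {(u, v). blocks k r A B b z u v} \<le> k + 1"
proof -
  define M where "M = {(u, v). blocks k r A B b z u v}"
  note uniq = occurs_unique[OF inj pos]
  have "M \<subseteq> (A \<union> B) \<times> (A \<union> B)" by (auto simp: M_def blocks_def occurs_def)
  then have finM: "finite M" using fin finite_subset by blast
  have "\<exists>x y. x < z \<and> z < y \<and> occurs r A B b z \<and> fst p \<noteq> snd p
     \<and> occurs r A B (fst p) x \<and> occurs r A B (snd p) y
     \<and> fst p \<notin> between r A B x y \<and> snd p \<notin> between r A B x y \<and> card (between r A B x y) = k + 1"
    if "p \<in> M" for p
    using that unfolding M_def blocks_def by (cases p) simp
  then obtain x y where xy: "\<And>p. p \<in> M \<Longrightarrow> x p < z \<and> z < y p \<and> occurs r A B b z \<and> fst p \<noteq> snd p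
     \<and> occurs r A B (fst p) (x p) \<and> occurs r A B (snd p) (y p)
     \<and> fst p \<notin> between r A B (x p) (y p) \<and> snd p \<notin> between r A B (x p) (y p)
     \<and> card (between r A B (x p) (y p)) = k + 1"
    by metis
  \<comment> \<open>With a common left end, the longer segment would contain the
    \<open>k + 1\<close> blockers of the shorter one and also its right end.\<close>
  have no: "\<not> y p < y q" if "p \<in> M" "q \<in> M" "x p = x q" for p q
  proof
    assume less: "y p < y q"
    have eq: "fst p = fst q"
      using xy[OF that(1)] xy[OF that(2)] that(3) uniq by metis
    have "x q < y p" using xy[OF that(1)] that(3) by linarith
    then have "snd p \<in> between r A B (x q) (y q)"
      using xy[OF that(1)] less unfolding between_def by auto
    moreover have "between r A B (x p) (y p) \<subseteq> between r A B (x q) (y q)"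
      using less that(3) by (intro between_mono) auto
    ultimately have "insert (snd p) (between r A B (x p) (y p)) \<subseteq> between r A B (x q) (y q)"
      by auto
    from card_mono[OF finite_between[OF fin] this] show False
      using xy[OF that(1)] xy[OF that(2)] fin by (simp add: finite_between)
  qed
  have same: "p = q" if "p \<in> M" "q \<in> M" "x p = x q" for p q
  proof -
    have "y p = y q" using no[OF that] no[OF that(2,1)] that(3) by simp
    then show ?thesis
      using xy[OF that(1)] xy[OF that(2)] that(3) uniq by (metis prod.expand)
  qed
  have "card M \<le> k + 1"
  proof (cases "M = {}")
    case False
    obtain p where p: "p \<in> M" "\<And>q. q \<in> M \<Longrightarrow> x p \<le> x q"
      using arg_min_if_finite[OF finM False, of x] by (auto simp: not_less)
    have less: "x p < x q" if "q \<in> M - {p}" for q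
      using p(2)[of q] same[of q p] p(1) that by fastforce
    \<comment> \<open>All segments contain \<open>z\<close>, so every left end other than the
      leftmost lies inside the segment of \<open>p\<close>.\<close>
    have inside: "fst q \<in> between r A B (x p) (y p)" if "q \<in> M - {p}" for q
    proof -
      have "x q < y p" using xy[OF p(1)] xy[of q] that by force
      then show ?thesis using less[OF that] xy[of q] that by (auto simp: between_def)
    qed
    \<comment> \<open>If one object were a left end at two points, the point nearer to
      \<open>z\<close> would lie inside the other segment, which \<open>blocks\<close>
      forbids.\<close>
    have inj1: "inj_on fst (M - {p})"
    proof (rule inj_onI, rule ccontr)
      fix q q' assume *: "q \<in> M - {p}" "q' \<in> M - {p}" "fst q = fst q'" "q \<noteq> q'"
      have False if "q \<in> M" "q' \<in> M" "fst q = fst q'" "x q < x q'" for q q'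
      proof -
        have "x q' < y q" using xy[OF that(1)] xy[OF that(2)] by linarith
        then have "fst q' \<in> between r A B (x q) (y q)"
          using xy[OF that(2)] that(4) unfolding between_def by auto
        then show False using xy[OF that(1)] that(3) by simp
      qed
      moreover have "x q \<noteq> x q'" using same[of q q'] *(1,2,4) by blast
      ultimately show False using * by (metis DiffD1 linorder_less_linear)
    qed
    \<comment> \<open>The blocker \<open>b\<close> is never a left end and takes one of the
      \<open>k + 1\<close> places, so at most \<open>k\<close> pairs besides \<open>p\<close>
      remain.\<close>
    have "b \<in> between r A B (x p) (y p)" using xy[OF p(1)] by (auto simp: between_def)
    have "fst q \<noteq> b" if "q \<in> M" for q
      using xy[OF that] by (auto simp: between_def)
    then have "fst ` (M - {p}) \<subseteq> between r A B (x p) (y p) - {b}" using inside by auto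
    then have "card (fst ` (M - {p})) \<le> card (between r A B (x p) (y p) - {b})"
      by (intro card_mono) (auto simp: finite_between fin)
    also have "\<dots> \<le> k" using xy[OF p(1)] \<open>b \<in> _\<close> fin by (simp add: finite_between)
    finally have "card (M - {p}) \<le> k" using card_image[OF inj1] by simp
    then show ?thesis using p(1) finM by simp
  qed simp
  then show ?thesis by (simp add: M_def)
qed

section \<open>Angular intervals and their one-sided limits\<close>

text \<open>Presence of the arc from \<open>a\<close> to \<open>b\<close> at angles just after, respectively just before,
  \<open>t\<close>. A full circle is an arc with \<open>b = a + 2 * pi\<close>.\<close>

definition present :: "real \<Rightarrow> real \<Rightarrow> real \<Rightarrow> bool" where
  "present a b t \<longleftrightarrow> (\<exists>n::int. a + 2 * pi * n \<le> t \<and> t < b + 2 * pi * n)"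

definition present_left :: "real \<Rightarrow> real \<Rightarrow> real \<Rightarrow> bool" where
  "present_left a b t \<longleftrightarrow> (\<exists>n::int. a + 2 * pi * n < t \<and> t \<le> b + 2 * pi * n)"

lemma present_periodic: "present a b (t + 2 * pi * of_int n) \<longleftrightarrow> present a b t"
proof -
  have "present a b (t + 2 * pi * of_int n)" if "present a b t" for t n
  proof -
    from that obtain m :: int where "a + 2 * pi * m \<le> t" "t < b + 2 * pi * m"
      by (auto simp: present_def)
    then show ?thesis unfolding present_def
      by (intro exI[of _ "m + n"]) (simp add: algebra_simps)
  qed
  from this[of t n] this[of "t + 2 * pi * of_int n" "- n"] show ?thesis by auto
qed

lemma present_left_periodic: "present_left a b (t + 2 * pi * of_int n) \<longleftrightarrow> present_left a b t"
proof -
  have "present_left a b (t + 2 * pi * of_int n)" if "present_left a b t" for t n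
  proof -
    from that obtain m :: int where "a + 2 * pi * m < t" "t \<le> b + 2 * pi * m"
      by (auto simp: present_left_def)
    then show ?thesis unfolding present_left_def
      by (intro exI[of _ "m + n"]) (simp add: algebra_simps)
  qed
  from this[of t n] this[of "t + 2 * pi * of_int n" "- n"] show ?thesis by auto
qed

text \<open>The intervals in \<open>present\<close> are closed at the start and open at the end,
  which makes presence right-continuous.\<close>

lemma eventually_present_right: "eventually (\<lambda>t'. present a b t' = present a b t) (at_right t)"
proof (cases "present a b t")
  case True
  then obtain n :: int where n: "a + 2 * pi * n \<le> t" "t < b + 2 * pi * n"
    by (auto simp: present_def)
  have "eventually (\<lambda>t'. t' \<in> {t<..<b + 2 * pi * n}) (at_right t)"
    using n(2) unfolding eventually_at_right_field by auto
  then show ?thesis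
    by eventually_elim (use True n in \<open>force simp: present_def\<close>)
next
  case False
  \<comment> \<open>\<open>n\<close> indexes the last copy that starts at or before
    \<open>t\<close>; earlier copies end no later than it, and the next start lies strictly
    ahead.\<close>
  define n :: int where "n = \<lfloor>(t - a) / (2 * pi)\<rfloor>"
  have "of_int n \<le> (t - a) / (2 * pi)" "(t - a) / (2 * pi) < of_int n + 1"
    unfolding n_def by linarith+
  then have n: "a + 2 * pi * n \<le> t" "t < a + 2 * pi * (n + 1)"
    by (simp_all add: field_simps)
  then have tb: "b + 2 * pi * n \<le> t" using False by (force simp: present_def)
  have "eventually (\<lambda>t'. t' \<in> {t<..<a + 2 * pi * (n + 1)}) (at_right t)"
    using n(2) unfolding eventually_at_right_field by auto
  then show ?thesis
  proof eventually_elim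
    case (elim t')
    then have t': "t < t'" "t' < a + 2 * pi * (n + 1)" by simp_all
    have False if m: "a + 2 * pi * of_int m \<le> t'" "t' < b + 2 * pi * of_int m" for m
    proof (cases "m \<le> n")
      case True
      then have "2 * pi * of_int m \<le> 2 * pi * of_int n" by simp
      then show False using m(2) tb t' by linarith
    next
      case False
      then have "of_int (n + 1) \<le> (of_int m :: real)" by linarith
      then have "2 * pi * of_int (n + 1) \<le> 2 * pi * (of_int m :: real)"
        by (intro mult_left_mono) auto
      then show False using m(1) t' by linarith
    qed
    then have "\<not> present a b t'" unfolding present_def by blast
    with False show ?case by simp
  qed
qed

lemma eventually_present_left: "eventually (\<lambda>t'. present a b t' = present_left a b t) (at_left t)"
proof (cases "present_left a b t")
  case True
  then obtain n :: int where n: "a + 2 * pi * n < t" "t \<le> b + 2 * pi * n"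
    by (auto simp: present_left_def)
  have "eventually (\<lambda>t'. t' \<in> {a + 2 * pi * n<..<t}) (at_left t)"
    using n(1) unfolding eventually_at_left_field by auto
  then show ?thesis
    by eventually_elim (use True n in \<open>auto simp: present_def intro!: exI[of _ n]\<close>)
next
  case False
  \<comment> \<open>The last copy that starts strictly before \<open>t\<close>; the
    \<open>- 1\<close> excludes one that starts exactly at \<open>t\<close>.\<close>
  define n :: int where "n = \<lceil>(t - a) / (2 * pi)\<rceil> - 1"
  have "of_int n < (t - a) / (2 * pi)" "(t - a) / (2 * pi) \<le> of_int n + 1"
    unfolding n_def by linarith+
  then have n: "a + 2 * pi * n < t" "t \<le> a + 2 * pi * (n + 1)"
    by (simp_all add: field_simps)
  then have tb: "b + 2 * pi * n < t" using False by (force simp: present_left_def)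
  have "eventually (\<lambda>t'. t' \<in> {b + 2 * pi * n<..<t}) (at_left t)"
    using tb unfolding eventually_at_left_field by auto
  then show ?thesis
  proof eventually_elim
    case (elim t')
    then have t': "b + 2 * pi * n < t'" "t' < t" by simp_all
    have False if m: "a + 2 * pi * of_int m \<le> t'" "t' < b + 2 * pi * of_int m" for m
    proof (cases "m \<le> n")
      case True
      then have "2 * pi * of_int m \<le> 2 * pi * of_int n" by simp
      then show False using m(2) tb t' by linarith
    next
      case False
      then have "of_int (n + 1) \<le> (of_int m :: real)" by linarith
      then have "2 * pi * of_int (n + 1) \<le> 2 * pi * (of_int m :: real)"
        by (intro mult_left_mono) auto
      then show False using m(1) n(2) t' by linarith
    qed
    then have "\<not> present a b t'" unfolding present_def by blast
    with False show ?case by simp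
  qed
qed

text \<open>The infimum of the angles from which \<open>X\<close> holds up to \<open>t1\<close> is a
  switch: right-continuity carries \<open>X\<close> to it, and if the left limit \<open>Y\<close>
  held there, \<open>X\<close> would already hold earlier.\<close>

lemma switch_on_time:
  fixes X Y :: "real \<Rightarrow> bool"
  assumes right: "\<And>t. eventually (\<lambda>t'. X t' = X t) (at_right t)"
    and left: "\<And>t. eventually (\<lambda>t'. X t' = Y t) (at_left t)"
    and "\<not> X t0" "X t1" "t0 < t1"
  obtains t where "X t" "\<not> Y t"
proof -
  define A where "A = {t. t0 \<le> t \<and> t \<le> t1 \<and> (\<forall>t'\<in>{t..t1}. X t')}"
  define t where "t = Inf A"
  have A: "t1 \<in> A" "bdd_below A"
    using assms by (auto simp: A_def intro!: bdd_belowI[of _ t0])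
  have t: "t0 \<le> t" "t \<le> t1"
    using A by (auto simp: t_def intro!: cInf_greatest cInf_lower) (auto simp: A_def)
  have on: "X t'" if t': "t < t'" "t' \<le> t1" for t'
  proof -
    obtain s where "s \<in> A" "s < t'"
      using t'(1) A unfolding t_def by (metis cInf_lessD empty_iff)
    then show ?thesis using t'(2) by (auto simp: A_def)
  qed
  have "X t"
  proof (cases "t = t1")
    case False
    then have "t < t1" using t by simp
    from right[of t] obtain c where c: "c > t" "\<And>y. t < y \<Longrightarrow> y < c \<Longrightarrow> X y = X t"
      unfolding eventually_at_right_field by auto
    define y where "y = min t1 ((t + c) / 2)"
    have "t < y" "y < c" "y \<le> t1" using c \<open>t < t1\<close> by (auto simp: y_def min_def)
    then show ?thesis using on[of y] c(2)[of y] by simp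
  qed (use assms in simp)
  then have "t0 < t" using t assms by (metis order_le_less)
  have "\<not> Y t"
  proof
    assume "Y t"
    with left[of t] obtain c where c: "c < t" "\<And>y. c < y \<Longrightarrow> y < t \<Longrightarrow> X y"
      unfolding eventually_at_left_field by auto
    define y where "y = max t0 ((t + c) / 2)"
    have y: "c < y" "y < t" "t0 \<le> y" using c \<open>t0 < t\<close> by (auto simp: y_def max_def)
    have "X t'" if "t' \<in> {y..t1}" for t'
      using that c(2)[of t'] y on[of t'] \<open>X t\<close> by (cases t' t rule: linorder_cases) auto
    then have "y \<in> A" using y t by (auto simp: A_def)
    then have "t \<le> y" unfolding t_def using A by (intro cInf_lower)
    then show False using y by simp
  qed
  with \<open>X t\<close> show ?thesis by (rule that)
qed

section \<open>The rotating line and its events\<close>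

lemma present_shift: "present a b (t + c) \<longleftrightarrow> present (a - c) (b - c) t"
  by (simp add: present_def algebra_simps)

lemma present_left_shift: "present_left a b (t + c) \<longleftrightarrow> present_left (a - c) (b - c) t"
  by (simp add: present_left_def algebra_simps)

text \<open>Only radii and angular intervals remain of the plane. \<open>apart\<close> is the trace
  of disjointness, and \<open>rank\<close> refines the order by radius to a linear order.\<close>

locale circular_sweep =
  fixes V :: "'a set" and r a b :: "'a \<Rightarrow> real" and rank :: "'a \<Rightarrow> nat" and k :: nat
  assumes finite_V: "finite V"
    and pos: "\<And>w. w \<in> V \<Longrightarrow> 0 < r w"
    and apart: "\<And>u v t. u \<in> V \<Longrightarrow> v \<in> V \<Longrightarrow> r u = r v \<Longrightarrow>
      present (a u) (b u) t \<Longrightarrow> present (a v) (b v) t \<Longrightarrow> u = v"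
    and rank_inj: "inj_on rank V"
    and rank_mono: "\<And>u v. u \<in> V \<Longrightarrow> v \<in> V \<Longrightarrow> r u < r v \<Longrightarrow> rank u < rank v"
begin

text \<open>\<open>S t\<close> is the state of the ray just after the angle \<open>t\<close>,
  \<open>L t\<close> the state just before. The opposite ray is read at
  \<open>t + pi\<close>.\<close>

definition S :: "real \<Rightarrow> 'a set" where "S t = {w \<in> V. present (a w) (b w) t}"

definition L :: "real \<Rightarrow> 'a set" where "L t = {w \<in> V. present_left (a w) (b w) t}"

text \<open>Simultaneous endings are processed in the order of \<open>rank\<close>, so that they
  unblock a pair one at a time.\<close>

definition T :: "nat \<Rightarrow> real \<Rightarrow> 'a set" where "T j t = L t - {w. w \<notin> S t \<and> rank w < j}"

abbreviation seesS where "seesS t \<equiv> sees k r (S t) (S (t + pi))"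
abbreviation seesL where "seesL t \<equiv> sees k r (L t) (L (t + pi))"

text \<open>Visibility along a ray (the side of an annular cone), and through the origin (a bow-tie).\<close>

definition ann where "ann u v \<longleftrightarrow> (\<exists>t. seesS t u (r u) v (r v))"
definition bow where "bow u v \<longleftrightarrow> (\<exists>t. seesS t u (- r u) v (r v))"

text \<open>\<open>w \<in> S t - L t\<close> expresses that \<open>w\<close> starts at
  \<open>t\<close>. Looking outward stays on the ray; looking inward may continue through the
  origin.\<close>

definition outward where
  "outward w = {v. \<exists>t y. w \<in> S t - L t \<and> seesS t w (r w) v y}"
definition inward where
  "inward w = {u. \<exists>t x. w \<in> S t - L t \<and> seesS t u x w (r w)}"
text \<open>An object that is always present has no starting event; its outward visibilities are
  recorded at the angle \<open>0\<close> instead.\<close>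

definition around where
  "around w = {v. \<exists>y. (\<forall>t. w \<in> S t) \<and> seesS 0 w (r w) v y}"
text \<open>The state is taken when \<open>w\<close> is about to be removed: ending objects of
  smaller \<open>rank\<close> are already gone from both rays.\<close>

definition unblocked where
  "unblocked w = {(u, v). \<exists>t. w \<in> L t - S t \<and> blocks k r (T (rank w) t) (T (rank w) (t + pi)) w (r w) u v}"

definition charged :: "'a \<Rightarrow> ('a \<times> 'a) set" where
  "charged w = {w} \<times> outward w \<union> {w} \<times> inward w \<union> {w} \<times> around w \<union> unblocked w"

lemma SL_subset: "S t \<subseteq> V" "L t \<subseteq> V" "T j t \<subseteq> L t" "T j t \<subseteq> V"
  by (auto simp: S_def L_def T_def)

lemma pos_SL: "w \<in> S t \<union> S t' \<Longrightarrow> 0 < r w" "w \<in> T j t \<union> T j t' \<Longrightarrow> 0 < r w"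
  using SL_subset pos by blast+

lemma finite_SL: "finite (S t)" "finite (L t)" "finite (T j t)"
  using SL_subset finite_V finite_subset by metis+

lemma S_periodic: "S (t + 2 * pi * of_int n) = S t"
  by (simp add: S_def present_periodic)

lemma L_periodic: "L (t + 2 * pi * of_int n) = L t"
  by (simp add: L_def present_left_periodic)

lemma T_periodic: "T j (t + 2 * pi * of_int n) = T j t"
  by (simp add: T_def S_periodic L_periodic)

lemma full_turn: "S (t + pi + pi) = S t" "L (t + pi + pi) = L t" "T j (t + pi + pi) = T j t"
  using S_periodic[of t 1] L_periodic[of t 1] T_periodic[of j t 1] by (simp_all add: add.assoc)

lemma inj_S: "inj_on r (S t)"
  using apart by (auto simp: inj_on_def S_def)

lemma S_right: "eventually (\<lambda>t'. S (t' + c) = S (t + c)) (at_right t)"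
proof -
  have "eventually (\<lambda>t'. \<forall>w\<in>V. present (a w) (b w) (t' + c) = present (a w) (b w) (t + c)) (at_right t)"
    using finite_V unfolding present_shift
    by (intro eventually_ball_finite ballI eventually_present_right)
  then show ?thesis by eventually_elim (auto simp: S_def)
qed

lemma S_left: "eventually (\<lambda>t'. S (t' + c) = L (t + c)) (at_left t)"
proof -
  have "eventually (\<lambda>t'. \<forall>w\<in>V. present (a w) (b w) (t' + c) = present_left (a w) (b w) (t + c)) (at_left t)"
    using finite_V unfolding present_shift present_left_shift
    by (intro eventually_ball_finite ballI eventually_present_left)
  then show ?thesis by eventually_elim (auto simp: S_def L_def)
qed

text \<open>One angle slightly below \<open>t\<close> serves both rays and all of the finitely many
  objects, so properties of \<open>S\<close> pass to \<open>L\<close>.\<close>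

lemma left_limit: obtains t' where "S t' = L t" "S (t' + pi) = L (t + pi)"
proof -
  have "eventually (\<lambda>t'. S t' = L t \<and> S (t' + pi) = L (t + pi)) (at_left t)"
    using S_left[of 0 t] S_left[of pi t] by (simp add: eventually_conj_iff)
  then show ?thesis
    using that eventually_happens'[OF trivial_limit_at_left_real] by blast
qed

lemma inj_L: "inj_on r (L t)"
proof -
  obtain t' where "S t' = L t" "S (t' + pi) = L (t + pi)" by (rule left_limit)
  then show ?thesis using inj_S[of t'] by simp
qed

lemma inj_T: "inj_on r (T j t)"
  using inj_on_subset[OF inj_L SL_subset(3)] .

lemma started:
  assumes "w \<in> S t - L t"
  shows "\<exists>n::int. t = a w + 2 * pi * n"
proof -
  obtain n :: int where n: "a w + 2 * pi * n \<le> t" "t < b w + 2 * pi * n"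
    using assms by (auto simp: S_def present_def)
  then have "\<not> a w + 2 * pi * n < t"
    using assms by (force simp: S_def L_def present_left_def)
  then show ?thesis using n by (intro exI[of _ n]) simp
qed

lemma ended:
  assumes "w \<in> L t - S t"
  shows "\<exists>n::int. t = b w + 2 * pi * n"
proof -
  obtain n :: int where n: "a w + 2 * pi * n < t" "t \<le> b w + 2 * pi * n"
    using assms by (auto simp: L_def present_left_def)
  then have "\<not> t < b w + 2 * pi * n"
    using assms by (force simp: S_def L_def present_def)
  then show ?thesis using n by (intro exI[of _ n]) simp
qed

text \<open>The angle of a start or end is determined up to full turns, and the state of the line is
  periodic. So each object has at most one starting and one ending event, whichever angle represents
  it.\<close>

lemma congruent_times:
  assumes "t = c + 2 * pi * of_int n" "t' = c + 2 * pi * of_int n'"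
  shows "S t = S t'" "S (t + pi) = S (t' + pi)" "T j t = T j t'" "T j (t + pi) = T j (t' + pi)"
proof -
  have "t' = t + 2 * pi * of_int (n' - n)" and "t' + pi = t + pi + 2 * pi * of_int (n' - n)"
    using assms by (simp_all add: algebra_simps)
  then show "S t = S t'" "S (t + pi) = S (t' + pi)" "T j t = T j t'" "T j (t + pi) = T j (t' + pi)"
    by (simp_all only: S_periodic T_periodic)
qed

lemma start_unique:
  assumes "w \<in> S t - L t" "w \<in> S t' - L t'"
  shows "S t = S t'" "S (t + pi) = S (t' + pi)"
proof -
  obtain n n' :: int where "t = a w + 2 * pi * n" "t' = a w + 2 * pi * n'"
    using started assms by blast
  then show "S t = S t'" "S (t + pi) = S (t' + pi)" by (rule congruent_times)+
qed

lemma end_unique: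
  assumes "w \<in> L t - S t" "w \<in> L t' - S t'"
  shows "T j t = T j t'" "T j (t + pi) = T j (t' + pi)"
proof -
  obtain n n' :: int where "t = b w + 2 * pi * n" "t' = b w + 2 * pi * n'"
    using ended assms by blast
  then show "T j t = T j t'" "T j (t + pi) = T j (t' + pi)" by (rule congruent_times)+
qed

section \<open>Bounds for the charges of one object\<close>

lemma card_outward: "card (outward w) \<le> k + 1" "finite (outward w)"
proof -
  show "card (outward w) \<le> k + 1"
  proof (cases "\<exists>t. w \<in> S t - L t")
    case True
    then obtain t where t: "w \<in> S t - L t" by blast
    have "outward w \<subseteq> {v. \<exists>y. seesS t w (r w) v y}"
    proof
      fix v assume "v \<in> outward w"
      then obtain t' y where *: "w \<in> S t' - L t'" "seesS t' w (r w) v y" by (auto simp: outward_def)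
      then have "S t' = S t" "S (t' + pi) = S (t + pi)"
        using start_unique[OF *(1) t] by simp_all
      then show "v \<in> {v. \<exists>y. seesS t w (r w) v y}" using *(2) by auto
    qed
    moreover have "{v. \<exists>y. seesS t w (r w) v y} \<subseteq> V"
      using SL_subset by (auto simp: sees_def occurs_def)
    moreover have "card {v. \<exists>y. seesS t w (r w) v y} \<le> k + 1"
      by (rule card_seen_right[OF finite_SL(1,1) inj_S inj_S pos_SL(1)])
    ultimately show ?thesis
      using finite_V by (meson card_mono finite_subset le_trans)
  next
    case False
    then have "outward w = {}" by (auto simp: outward_def)
    then show ?thesis by simp
  qed
  have "outward w \<subseteq> V"
    using SL_subset by (auto simp: outward_def sees_def occurs_def)
  then show "finite (outward w)" using finite_V finite_subset by blast
qed

lemma card_inward: "card (inward w) \<le> k + 1" "finite (inward w)"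
proof -
  show "card (inward w) \<le> k + 1"
  proof (cases "\<exists>t. w \<in> S t - L t")
    case True
    then obtain t where t: "w \<in> S t - L t" by blast
    have "inward w \<subseteq> {u. \<exists>x. seesS t u x w (r w)}"
    proof
      fix u assume "u \<in> inward w"
      then obtain t' x where *: "w \<in> S t' - L t'" "seesS t' u x w (r w)" by (auto simp: inward_def)
      then have "S t' = S t" "S (t' + pi) = S (t + pi)"
        using start_unique[OF *(1) t] by simp_all
      then show "u \<in> {u. \<exists>x. seesS t u x w (r w)}" using *(2) by auto
    qed
    moreover have "{u. \<exists>x. seesS t u x w (r w)} \<subseteq> V"
      using SL_subset by (auto simp: sees_def occurs_def)
    moreover have "card {u. \<exists>x. seesS t u x w (r w)} \<le> k + 1"
      by (rule card_seen_left[OF finite_SL(1,1) inj_S inj_S pos_SL(1)])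
    ultimately show ?thesis
      using finite_V by (meson card_mono finite_subset le_trans)
  next
    case False
    then have "inward w = {}" by (auto simp: inward_def)
    then show ?thesis by simp
  qed
  have "inward w \<subseteq> V"
    using SL_subset by (auto simp: inward_def sees_def occurs_def)
  then show "finite (inward w)" using finite_V finite_subset by blast
qed

lemma card_around: "card (around w) \<le> k + 1" "finite (around w)"
proof -
  have "around w \<subseteq> {v. \<exists>y. seesS 0 w (r w) v y}" by (auto simp: around_def)
  moreover have "{v. \<exists>y. seesS 0 w (r w) v y} \<subseteq> V"
    using SL_subset by (auto simp: sees_def occurs_def)
  moreover have "card {v. \<exists>y. seesS 0 w (r w) v y} \<le> k + 1"
    by (rule card_seen_right[OF finite_SL(1,1) inj_S inj_S pos_SL(1)])
  ultimately show "card (around w) \<le> k + 1" "finite (around w)"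
    using finite_V by (meson card_mono finite_subset le_trans)+
qed

lemma card_unblocked: "card (unblocked w) \<le> k + 1" "finite (unblocked w)"
proof -
  show "card (unblocked w) \<le> k + 1"
  proof (cases "\<exists>t. w \<in> L t - S t")
    case True
    then obtain t where t: "w \<in> L t - S t" by blast
    let ?B = "{(u, v). blocks k r (T (rank w) t) (T (rank w) (t + pi)) w (r w) u v}"
    have "unblocked w \<subseteq> ?B"
    proof
      fix p assume "p \<in> unblocked w"
      then obtain t' u v where *: "w \<in> L t' - S t'" "p = (u, v)"
        "blocks k r (T (rank w) t') (T (rank w) (t' + pi)) w (r w) u v"
        by (auto simp: unblocked_def)
      then have "T (rank w) t' = T (rank w) t" "T (rank w) (t' + pi) = T (rank w) (t + pi)"
        using end_unique[OF *(1) t] by simp_all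
      then show "p \<in> ?B" using * by auto
    qed
    moreover have "?B \<subseteq> V \<times> V"
      by (auto dest!: blocks_mem dest: subsetD[OF SL_subset(4)])
    moreover have "card ?B \<le> k + 1"
      by (rule card_blocks[OF finite_SL(3,3) inj_T inj_T pos_SL(2)])
    ultimately show ?thesis
      using finite_V by (meson card_mono finite_SigmaI finite_subset le_trans)
  next
    case False
    then have "unblocked w = {}" by (auto simp: unblocked_def)
    then show ?thesis by simp
  qed
  have "unblocked w \<subseteq> V \<times> V"
    unfolding unblocked_def by (auto dest!: blocks_mem dest: subsetD[OF SL_subset(4)])
  then show "finite (unblocked w)" using finite_V finite_subset by blast
qed

section \<open>Every visible pair is charged\<close>

text \<open>Endings are carried out in the order of \<open>rank\<close>. As \<open>rank\<close> is
  injective, each stage loses at most one blocker, so their number is exactly \<open>k + 1\<close>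
  just before it first drops to \<open>k\<close>; the object lost then is the one sought.\<close>

lemma unblocking_object:
  assumes seen: "seesS t u x v y" and unseen: "\<not> seesL t u x v y"
    and occ: "occurs r (L t) (L (t + pi)) u x" "occurs r (L t) (L (t + pi)) v y"
  obtains w where "w \<in> V" "w \<noteq> u" "w \<noteq> v"
    "occurs r (T (rank w) t) (T (rank w) (t + pi)) u x"
    "occurs r (T (rank w) t) (T (rank w) (t + pi)) v y"
    "card (between r (T (rank w) t) (T (rank w) (t + pi)) x y - {u, v}) = k + 1"
    "w \<in> L t - S t \<and> x < r w \<and> r w < y \<or> w \<in> L (t + pi) - S (t + pi) \<and> x < - r w \<and> - r w < y"
proof -
  define K where "K j = between r (T j t) (T j (t + pi)) x y - {u, v}" for j
  have finK: "finite (K j)" for j by (simp add: K_def finite_between finite_SL)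
  \<comment> \<open>Beyond every rank: at stage \<open>n\<close> all endings have been carried
    out.\<close>
  define n where "n = Suc (Max (rank ` V))"
  have "rank w < n" if "w \<in> V" for w
    using that finite_V by (simp add: n_def le_imp_less_Suc)
  then have "T n t' \<subseteq> S t'" for t'
    using SL_subset(2)[of t'] by (auto simp: T_def)
  then have "K n \<subseteq> between r (S t) (S (t + pi)) x y - {u, v}"
    unfolding K_def by (intro Diff_mono between_mono) auto
  then have "card (K n) \<le> card (between r (S t) (S (t + pi)) x y - {u, v})"
    by (intro card_mono) (auto intro: finite_between finite_SL)
  then have "card (K n) \<le> k" using seen by (simp add: sees_def)
  then obtain m where m: "card (K m) \<le> k" "\<And>i. i < m \<Longrightarrow> \<not> card (K i) \<le> k"
    using ex_least_nat_le[of "\<lambda>j. card (K j) \<le> k" n] by auto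
  \<comment> \<open>Stage \<open>0\<close> is the state before \<open>t\<close>, where the pair is
    still blocked, so the first good stage has a predecessor \<open>j\<close>.\<close>
  have "T 0 t' = L t'" for t' by (auto simp: T_def)
  then have "\<not> card (K 0) \<le> k"
    using seen unseen occ by (auto simp: K_def sees_def)
  then obtain j where "m = Suc j" using m(1) by (cases m) auto
  then have j: "card (K (Suc j)) \<le> k" "k < card (K j)" using m(1) m(2)[of j] by auto
  have lost: "rank w = j \<and> w \<in> V \<and> w \<noteq> u \<and> w \<noteq> v \<and> (w \<in> L t - S t \<and> x < r w \<and> r w < y \<or>
      w \<in> L (t + pi) - S (t + pi) \<and> x < - r w \<and> - r w < y)" if "w \<in> K j - K (Suc j)" for w
  proof -
    obtain z where z: "x < z" "z < y" "occurs r (T j t) (T j (t + pi)) w z"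
      "\<not> occurs r (T (Suc j) t) (T (Suc j) (t + pi)) w z" "w \<noteq> u" "w \<noteq> v"
      using \<open>w \<in> K j - K (Suc j)\<close> by (auto simp: K_def between_def)
    then show ?thesis using SL_subset by (auto simp: occurs_def T_def)
  qed
  obtain w where w: "w \<in> K j - K (Suc j)"
    using j card_mono[OF finK[of "Suc j"], of "K j"] by (metis DiffI leD le_trans subsetI)
  have "K j - K (Suc j) \<subseteq> {w}"
    using lost w rank_inj by (metis inj_onD singletonI subsetI)
  then have "K j \<subseteq> insert w (K (Suc j))" by auto
  then have "card (K j) \<le> card (insert w (K (Suc j)))"
    by (intro card_mono) (auto simp: finK)
  then have cK: "card (K j) = k + 1" using j by (simp add: card_insert_if finK split: if_splits)
  \<comment> \<open>Ends of the pair that are there both before and after \<open>t\<close> are never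
    removed; positive radii exclude a change of ray.\<close>
  have occT: "occurs r (T j t) (T j (t + pi)) u x" "occurs r (T j t) (T j (t + pi)) v y"
    using seen occ pos_SL(1)[of u t "t + pi"] pos_SL(1)[of v t "t + pi"]
    by (auto simp: sees_def occurs_def T_def)
  show ?thesis
    using that[of w] lost[OF w] cK occT by (auto simp: K_def)
qed

text \<open>A pair comes into sight because its right end starts, its left end starts, or a blocker
  ends. In the last case \<open>blocks\<close> also demands that no end recurs inside the segment;
  \<open>minimal\<close> leaves this to the two applications.\<close>

lemma charge_switch:
  assumes seen: "seesS t u x v (r v)" and unseen: "\<not> seesL t u x v (r v)"
    and x: "x = r u \<or> x = - r u" and V: "u \<in> V" "v \<in> V"
    and minimal: "\<And>w. \<lbrakk>w \<in> V; w \<noteq> u; w \<noteq> v; occurs r (L t) (L (t + pi)) u x; v \<in> L t;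
      card (between r (T (rank w) t) (T (rank w) (t + pi)) x (r v) - {u, v}) = k + 1;
      w \<in> between r (T (rank w) t) (T (rank w) (t + pi)) x (r v)\<rbrakk> \<Longrightarrow>
      u \<notin> between r (T (rank w) t) (T (rank w) (t + pi)) x (r v) \<and>
      v \<notin> between r (T (rank w) t) (T (rank w) (t + pi)) x (r v)"
  shows "\<exists>w\<in>V. (u, v) \<in> charged w \<or> (v, u) \<in> charged w"
proof -
  have p: "0 < r u" "0 < r v" using pos V by auto
  then have vS: "v \<in> S t" and uS: "occurs r (S t) (S (t + pi)) u x"
    using seen by (auto simp: sees_def occurs_def)
  consider "v \<notin> L t" | "\<not> occurs r (L t) (L (t + pi)) u x"
    | "v \<in> L t" "occurs r (L t) (L (t + pi)) u x" by blast
  then show ?thesis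
  proof cases
    case 1
    then have "u \<in> inward v" using vS seen by (auto simp: inward_def)
    then show ?thesis using V by (auto simp: charged_def)
  next
    case 2
    show ?thesis
    proof (cases "u \<in> S t \<and> x = r u")
      case True
      then have "v \<in> outward u" using 2 seen by (auto simp: outward_def occurs_def)
      then show ?thesis using V by (auto simp: charged_def)
    next
      case False
      then have xu: "x = - r u" "u \<in> S (t + pi) - L (t + pi)"
        using uS 2 by (auto simp: occurs_def)
      \<comment> \<open>A half-turn puts the start of \<open>u\<close> on the positive ray, where
        \<open>v\<close> is an inward neighbour.\<close>
      have "seesS (t + pi) v (- r v) u (r u)"
        using seen xu(1) sees_flip[of k r "S (t + pi)" "S t" v "r v" u x] unfolding full_turn by simp
      then have "v \<in> inward u" using xu(2) unfolding inward_def by blast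
      then show ?thesis using V by (auto simp: charged_def)
    qed
  next
    case 3
    then have "occurs r (L t) (L (t + pi)) v (r v)" by (simp add: occurs_def)
    from unblocking_object[OF seen unseen 3(2) this]
    obtain w where w: "w \<in> V" "w \<noteq> u" "w \<noteq> v"
      "occurs r (T (rank w) t) (T (rank w) (t + pi)) u x"
      "occurs r (T (rank w) t) (T (rank w) (t + pi)) v (r v)"
      "card (between r (T (rank w) t) (T (rank w) (t + pi)) x (r v) - {u, v}) = k + 1"
      "w \<in> L t - S t \<and> x < r w \<and> r w < r v \<or>
        w \<in> L (t + pi) - S (t + pi) \<and> x < - r w \<and> - r w < r v"
      by blast
    let ?A = "T (rank w) t" let ?B = "T (rank w) (t + pi)"
    have "w \<in> between r ?A ?B x (r v)"
      using w(7) by (auto simp: between_def occurs_def T_def)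
    from minimal[OF w(1-3) 3(2,1) w(6) this]
    have min: "u \<notin> between r ?A ?B x (r v)" "v \<notin> between r ?A ?B x (r v)" by auto
    then have cB: "card (between r ?A ?B x (r v)) = k + 1" using w(6) by simp
    have uv: "u \<noteq> v" using seen by (simp add: sees_def)
    from w(7) show ?thesis
    proof
      assume *: "w \<in> L t - S t \<and> x < r w \<and> r w < r v"
      then have "occurs r ?A ?B w (r w)" by (auto simp: occurs_def T_def)
      then have "blocks k r ?A ?B w (r w) u v"
        using * w(4,5) min cB uv unfolding blocks_def by blast
      then have "(u, v) \<in> unblocked w" using * by (auto simp: unblocked_def)
      then show ?thesis using w(1) by (auto simp: charged_def)
    next
      assume *: "w \<in> L (t + pi) - S (t + pi) \<and> x < - r w \<and> - r w < r v"
      then have "occurs r ?A ?B w (- r w)" by (auto simp: occurs_def T_def)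
      then have "blocks k r ?A ?B w (- r w) u v"
        using * w(4,5) min cB uv unfolding blocks_def by blast
      \<comment> \<open>The ending is on the opposite ray; a half-turn brings it to the positive ray
        and reverses the pair.\<close>
      then have "blocks k r ?B (T (rank w) (t + pi + pi)) w (r w) v u"
        using blocks_flip[of k r ?B ?A w "- r w"] unfolding full_turn by simp
      then have "(v, u) \<in> unblocked w" using * by (auto simp: unblocked_def)
      then show ?thesis using w(1) by (auto simp: charged_def)
    qed
  qed
qed

lemma seesS_right: "eventually (\<lambda>t'. seesS t' u x v y = seesS t u x v y) (at_right t)"
  using S_right[of 0 t] S_right[of pi t] by eventually_elim simp

lemma seesS_left: "eventually (\<lambda>t'. seesS t' u x v y = seesL t u x v y) (at_left t)"
  using S_left[of 0 t] S_left[of pi t] by eventually_elim simp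

lemma seesS_switch:
  assumes "seesS t1 u x v y" "\<not> seesS t0 u x v y"
  obtains t where "seesS t u x v y" "\<not> seesL t u x v y"
proof -
  \<comment> \<open>Enough full turns to bring the visible angle beyond \<open>t0\<close>.\<close>
  define n where "n = \<lceil>(t0 - t1) / (2 * pi)\<rceil> + 1"
  have "(t0 - t1) / (2 * pi) < of_int n" unfolding n_def by linarith
  then have "t0 < t1 + 2 * pi * of_int n" by (simp add: field_simps)
  moreover have "S (t1 + 2 * pi * of_int n + pi) = S (t1 + pi)"
    using S_periodic[of "t1 + pi" n] by (simp add: algebra_simps)
  then have "seesS (t1 + 2 * pi * of_int n) u x v y" using assms(1) by (simp add: S_periodic)
  ultimately show ?thesis
    using switch_on_time[OF seesS_right seesS_left assms(2)] that by blast
qed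

lemma seesL_imp_seesS:
  assumes "seesL t u x v y"
  shows "\<exists>t'. seesS t' u x v y"
proof -
  obtain t' where "S t' = L t" "S (t' + pi) = L (t + pi)" by (rule left_limit)
  then show ?thesis using assms by (intro exI[of _ t']) simp
qed

text \<open>A pair visible at all angles is charged to its inner object, which is then always
  present. Otherwise there is a switch, and the ends cannot recur inside the segment because their
  other occurrences lie beyond the origin.\<close>

lemma charge_ann:
  assumes "ann u v" "u \<in> V" "v \<in> V"
  shows "\<exists>w\<in>V. (u, v) \<in> charged w \<or> (v, u) \<in> charged w"
proof (cases "\<forall>t. seesS t u (r u) v (r v)")
  case True
  have "0 < r u" "0 < r v" using assms pos by auto
  then have "u \<in> S t" for t using True[rule_format, of t] by (auto simp: sees_def occurs_def)
  moreover have "seesS 0 u (r u) v (r v)" using True by blast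
  ultimately have "v \<in> around u" unfolding around_def by blast
  then show ?thesis using assms by (auto simp: charged_def)
next
  case False
  then obtain t where t: "seesS t u (r u) v (r v)" "\<not> seesL t u (r u) v (r v)"
    using assms(1) seesS_switch unfolding ann_def by metis
  have p: "0 < r u" "0 < r v" using assms pos by auto
  show ?thesis
    by (rule charge_switch[OF t]) (use p assms in \<open>auto simp: between_def occurs_def\<close>)
qed

text \<open>Here the order of \<open>rank\<close> matters: whatever lies between \<open>u\<close> and \<open>v\<close> on the ray has a larger
  radius than \<open>u\<close>, so it is still there as long as \<open>u\<close> is.\<close>

lemma bow_minimal:
  assumes "\<not> ann u v" "u \<in> V" "v \<in> V" "w \<in> V" "w \<noteq> u" "w \<noteq> v"
    and seen: "seesS t u (- r u) v (r v)" and "v \<in> L t"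
    and card: "card (between r (T (rank w) t) (T (rank w) (t + pi)) (- r u) (r v) - {u, v}) = k + 1"
    and w: "w \<in> between r (T (rank w) t) (T (rank w) (t + pi)) (- r u) (r v)"
  shows "u \<notin> between r (T (rank w) t) (T (rank w) (t + pi)) (- r u) (r v)"
proof
  let ?K = "between r (T (rank w) t) (T (rank w) (t + pi)) (- r u) (r v)"
  assume "u \<in> ?K"
  have p: "0 < r u" "0 < r v" "0 < r w" using assms pos by auto
  from \<open>u \<in> ?K\<close> have u: "u \<in> T (rank w) t" "r u < r v"
    using p by (auto simp: between_def occurs_def)
  have uv: "u \<noteq> v" using seen by (simp add: sees_def)
  have vS: "v \<in> S t" using seen p by (auto simp: sees_def occurs_def)
  let ?M = "between r (L t) (L (t + pi)) (r u) (r v) - {u, v}"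
  \<comment> \<open>Without visibility along a ray, more than \<open>k\<close> objects separate
    \<open>u\<close> from \<open>v\<close> on the ray just before \<open>t\<close>.\<close>
  have "\<not> seesL t u (r u) v (r v)" using seesL_imp_seesS assms(1) unfolding ann_def by blast
  then have M: "k < card ?M"
    using u uv \<open>v \<in> L t\<close> SL_subset(3) by (auto simp: sees_def occurs_def)
  \<comment> \<open>If \<open>u\<close> stayed, the shorter segment on the ray would inherit
    visibility from the one through the origin.\<close>
  have "u \<notin> S t"
  proof
    assume "u \<in> S t"
    have "between r (S t) (S (t + pi)) (r u) (r v) \<subseteq> between r (S t) (S (t + pi)) (- r u) (r v)"
      using p by (intro between_mono) auto
    then have "card (between r (S t) (S (t + pi)) (r u) (r v) - {u, v})
        \<le> card (between r (S t) (S (t + pi)) (- r u) (r v) - {u, v})"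
      by (intro card_mono) (auto intro: finite_between finite_SL)
    then have "seesS t u (r u) v (r v)"
      using seen \<open>u \<in> S t\<close> vS u uv by (auto simp: sees_def occurs_def)
    then show False using assms(1) by (auto simp: ann_def)
  qed
  \<comment> \<open>So \<open>u\<close> ends at \<open>t\<close> but is still there when
    \<open>w\<close> is about to be removed; hence \<open>w\<close> lies no farther out than
    \<open>u\<close>.\<close>
  then have "rank w \<le> rank u" using u by (auto simp: T_def)
  then have wu: "r w \<le> r u" using rank_mono[of u w] assms by (meson leI leD)
  have M_ray: "w' \<in> L t \<and> r u < r w' \<and> r w' < r v" if "w' \<in> ?M" for w'
    using that p pos[of w'] SL_subset(2) by (fastforce simp: between_def occurs_def)
  \<comment> \<open>The objects beyond \<open>u\<close> have larger rank than \<open>w\<close>, so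
    they still block; with \<open>w\<close> itself they number at least \<open>k + 2\<close>, more
    than \<open>card\<close> allows.\<close>
  have "?M \<subseteq> ?K - {u, v}"
  proof
    fix w' assume w': "w' \<in> ?M"
    have "rank w < rank w'"
      using M_ray[OF w'] wu \<open>w \<in> V\<close> SL_subset(2)[of t] by (intro rank_mono) auto
    then have "w' \<in> T (rank w) t" using M_ray[OF w'] by (auto simp: T_def)
    then show "w' \<in> ?K - {u, v}"
      using w' M_ray[OF w'] p by (auto simp: between_def occurs_def intro!: exI[of _ "r w'"])
  qed
  moreover have "w \<notin> ?M" using M_ray[of w] wu by auto
  moreover have "w \<in> ?K - {u, v}" using w assms(5,6) by auto
  ultimately have "insert w ?M \<subseteq> ?K - {u, v}" by auto
  then have "card (insert w ?M) \<le> card (?K - {u, v})"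
    by (intro card_mono) (auto intro: finite_between finite_SL)
  moreover have "card (insert w ?M) = Suc (card ?M)"
    using \<open>w \<notin> ?M\<close> by (intro card_insert_disjoint) (auto intro: finite_between finite_SL)
  ultimately show False using M card by simp
qed

text \<open>If the two see each other through the origin at all angles, both are always present, and
  the part of the segment beyond the inner one makes them visible along a ray, which is excluded.
  Otherwise \<open>bow_minimal\<close>, applied from both ends by a half-turn, supplies what
  \<open>charge_switch\<close> asks for.\<close>

lemma charge_bow:
  assumes bow: "bow u v" and no: "\<not> ann u v" "\<not> ann v u" and V: "u \<in> V" "v \<in> V"
  shows "\<exists>w\<in>V. (u, v) \<in> charged w \<or> (v, u) \<in> charged w"
proof -
  have p: "0 < r u" "0 < r v" using V pos by auto
  have flip: "seesS (t + pi) v (- r v) u (r u) \<longleftrightarrow> seesS t u (- r u) v (r v)" for t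
    using sees_flip[of k r "S (t + pi)" "S t" v "r v" u "- r u"] unfolding full_turn by simp
  show ?thesis
  proof (cases "\<forall>t. seesS t u (- r u) v (r v)")
    case True
    have "u \<in> S (t + pi)" "v \<in> S t" for t
      using True[rule_format, of t] p by (auto simp: sees_def occurs_def)
    then have S: "u \<in> S t" "v \<in> S t" for t
      using full_turn(1) by metis+
    have uv: "u \<noteq> v" using True by (auto simp: sees_def)
    then have "r u \<noteq> r v" using S[of 0] inj_S[of 0] by (auto dest: inj_onD)
    have ann: "ann u v" if "seesS t u (- r u) v (r v)" "r u < r v" "u \<noteq> v" "0 < r u"
      "u \<in> S t" "v \<in> S t" for u v t
    proof -
      have "between r (S t) (S (t + pi)) (r u) (r v) \<subseteq> between r (S t) (S (t + pi)) (- r u) (r v)"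
        using that by (intro between_mono) auto
      then have "card (between r (S t) (S (t + pi)) (r u) (r v) - {u, v})
          \<le> card (between r (S t) (S (t + pi)) (- r u) (r v) - {u, v})"
        by (intro card_mono) (auto intro: finite_between finite_SL)
      then have "seesS t u (r u) v (r v)"
        using that by (auto simp: sees_def occurs_def)
      then show ?thesis by (auto simp: ann_def)
    qed
    show ?thesis
    proof (cases "r u < r v")
      case less: True
      then show ?thesis using ann[of 0 u v] True S uv p no by blast
    next
      case False
      then have "r v < r u" using \<open>r u \<noteq> r v\<close> by simp
      moreover have "seesS (0 + pi) v (- r v) u (r u)" using True flip by blast
      ultimately show ?thesis using ann[of "0 + pi" v u] S uv p no by blast
    qed
  next
    case False
    then obtain t where t: "seesS t u (- r u) v (r v)" "\<not> seesL t u (- r u) v (r v)"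
      using bow seesS_switch unfolding bow_def by metis
    show ?thesis
    proof (rule charge_switch[OF t _ V])
      fix w assume w: "w \<in> V" "w \<noteq> u" "w \<noteq> v" and occ: "occurs r (L t) (L (t + pi)) u (- r u)" "v \<in> L t"
        and card: "card (between r (T (rank w) t) (T (rank w) (t + pi)) (- r u) (r v) - {u, v}) = k + 1"
        and btw: "w \<in> between r (T (rank w) t) (T (rank w) (t + pi)) (- r u) (r v)"
      have eq: "between r (T (rank w) (t + pi)) (T (rank w) (t + pi + pi)) (- r v) (r u)
          = between r (T (rank w) t) (T (rank w) (t + pi)) (- r u) (r v)"
        using between_flip[of r "T (rank w) (t + pi)" "T (rank w) t" "r v" "- r u"] unfolding full_turn by simp
      have "u \<in> L (t + pi)" using occ(1) p by (auto simp: occurs_def)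
      then have "v \<notin> between r (T (rank w) (t + pi)) (T (rank w) (t + pi + pi)) (- r v) (r u)"
        using bow_minimal[of v u w "t + pi"] no V w t(1) flip card btw unfolding eq
        by (simp add: insert_commute)
      moreover have "u \<notin> between r (T (rank w) t) (T (rank w) (t + pi)) (- r u) (r v)"
        by (rule bow_minimal[OF no(1) V w t(1) occ(2) card btw])
      ultimately show "u \<notin> between r (T (rank w) t) (T (rank w) (t + pi)) (- r u) (r v) \<and>
          v \<notin> between r (T (rank w) t) (T (rank w) (t + pi)) (- r u) (r v)"
        unfolding eq by blast
    qed simp
  qed
qed

section \<open>Counting the edges\<close>

text \<open>Objects that are always present are charged through \<open>around\<close> only, all
  others through the remaining three kinds only. An outermost object sees nothing outward, which
  leaves \<open>inward\<close> and \<open>unblocked\<close>.\<close>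

lemma card_charged:
  shows "finite (charged w)" "card (charged w) \<le> 3 * k + 3"
    and "(\<And>v. v \<in> V \<Longrightarrow> r v \<le> r w) \<Longrightarrow> w \<in> V \<Longrightarrow> card (charged w) \<le> 2 * k + 2"
proof -
  show "finite (charged w)"
    by (simp add: charged_def card_outward card_inward card_around card_unblocked)
  have le: "card (charged w) \<le> card (outward w) + card (inward w) + card (around w) + card (unblocked w)"
    unfolding charged_def
    by (intro order_trans[OF card_Un_le] add_mono)
      (auto simp: card_cartesian_product intro: order_trans[OF card_Un_le])
  have full: "outward w = {}" "inward w = {}" "unblocked w = {}" if "\<forall>t. w \<in> S t"
  proof -
    have "w \<in> L t" for t using that left_limit[of t] by metis
    then show "outward w = {}" "inward w = {}" "unblocked w = {}"
      using that by (auto simp: outward_def inward_def unblocked_def)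
  qed
  have arc: "around w = {}" if "\<not> (\<forall>t. w \<in> S t)"
    using that by (auto simp: around_def)
  show "card (charged w) \<le> 3 * k + 3"
  proof (cases "\<forall>t. w \<in> S t")
    case True
    then show ?thesis using le full card_around(1)[of w] by simp
  next
    case False
    then show ?thesis
      using le arc card_outward(1)[of w] card_inward(1)[of w] card_unblocked(1)[of w] by simp
  qed
  assume outer: "\<And>v. v \<in> V \<Longrightarrow> r v \<le> r w" and "w \<in> V"
  have no: "\<not> seesS t w (r w) v y" for t v y
  proof
    assume "seesS t w (r w) v y"
    then have "v \<in> V" "r w < y" "y = r v \<or> y = - r v"
      using SL_subset by (auto simp: sees_def occurs_def)
    then show False using outer[of v] pos[of v] pos[OF \<open>w \<in> V\<close>] by auto
  qed
  then have "outward w = {}" "around w = {}"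
    by (auto simp: outward_def around_def simp del: add_0)
  then show "card (charged w) \<le> 2 * k + 2"
    using le card_inward(1)[of w] card_unblocked(1)[of w] by simp
qed

definition linked where "linked u v \<longleftrightarrow> u \<in> V \<and> v \<in> V \<and> (ann u v \<or> ann v u \<or> bow u v \<or> bow v u)"

text \<open>Double counting of ordered pairs: each charge accounts for at most two of them, one per
  orientation.\<close>

lemma ex_low_degree:
  assumes "V \<noteq> {}"
  shows "\<exists>v\<in>V. card {u. linked v u} < 6 * k + 6"
proof (rule ccontr)
  assume "\<not> ?thesis"
  then have high: "6 * k + 6 \<le> card {u. linked v u}" if "v \<in> V" for v
    using that by (simp add: not_less)
  define Q where "Q = (\<Union>w\<in>V. charged w)"
  have finQ: "finite Q" using finite_V card_charged(1) by (simp add: Q_def)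
  have "(u, v) \<in> Q \<or> (v, u) \<in> Q" if "linked u v" for u v
    using that charge_ann[of u v] charge_ann[of v u] charge_bow[of u v] charge_bow[of v u]
    unfolding linked_def Q_def by blast
  then have sub: "Sigma V (\<lambda>v. {u. linked v u}) \<subseteq> Q \<union> Q\<inverse>" by auto
  obtain m where m: "m \<in> V" "\<And>v. v \<in> V \<Longrightarrow> r v \<le> r m"
    using arg_min_if_finite[OF finite_V assms, of "\<lambda>v. - r v"] by (auto simp: not_less)
  have "card Q \<le> (\<Sum>w\<in>V. card (charged w))"
    unfolding Q_def by (rule card_UN_le[OF finite_V])
  \<comment> \<open>Strictness comes from the outermost \<open>m\<close>, where
    \<open>2 * k + 2 < 3 * k + 3\<close>.\<close>
  also have "\<dots> < (\<Sum>w\<in>V. 3 * k + 3)"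
    using m card_charged(2) card_charged(3)[of m]
    by (intro sum_strict_mono_ex1 finite_V bexI[of _ m]) auto
  finally have Q: "card Q < card V * (3 * k + 3)" by simp
  have "card V * (6 * k + 6) \<le> (\<Sum>v\<in>V. card {u. linked v u})"
    using high sum_bounded_below[of V "6 * k + 6" "\<lambda>v. card {u. linked v u}"] by simp
  also have "\<dots> = card (Sigma V (\<lambda>v. {u. linked v u}))"
    using finite_V by (intro card_SigmaI[symmetric]) (auto simp: linked_def)
  also have "\<dots> \<le> card (Q \<union> Q\<inverse>)"
    using sub finQ by (intro card_mono) auto
  also have "\<dots> \<le> card Q + card Q"
    using card_Un_le[of Q "Q\<inverse>"] by simp
  finally show False using Q by (simp add: algebra_simps)
qed

end

section \<open>From objects in the plane to the rotating line\<close>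

text \<open>The rank counts predecessors in the order by radius, with ties broken by an arbitrary
  injective numbering.\<close>

lemma ex_rank:
  fixes r :: "'a \<Rightarrow> real"
  assumes "finite V"
  obtains rank :: "'a \<Rightarrow> nat" where "inj_on rank V"
    "\<And>u v. u \<in> V \<Longrightarrow> v \<in> V \<Longrightarrow> r u < r v \<Longrightarrow> rank u < rank v"
proof -
  obtain g :: "'a \<Rightarrow> nat" where g: "inj_on g V"
    using finite_imp_inj_to_nat_seg[OF assms] by blast
  define before where "before u v \<longleftrightarrow> r u < r v \<or> r u = r v \<and> g u < g v" for u v
  define rank where "rank v = card {u \<in> V. before u v}" for v
  have rank: "rank u < rank v" if "before u v" "u \<in> V" for u v
    unfolding rank_def using that assms
    by (intro psubset_card_mono) (auto simp: before_def)
  have "inj_on rank V"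
  proof (rule inj_onI, rule ccontr)
    fix u v assume *: "u \<in> V" "v \<in> V" "rank u = rank v" "u \<noteq> v"
    then have "g u \<noteq> g v" using g by (auto dest: inj_onD)
    then have "before u v \<or> before v u" by (auto simp: before_def)
    then show False using rank * by (metis less_irrefl)
  qed
  moreover have "rank u < rank v" if "u \<in> V" "r u < r v" for u v
    using rank that by (simp add: before_def)
  ultimately show ?thesis using that by blast
qed

lemma rcis_periodic: "rcis q (t + 2 * pi * of_int n) = rcis q t"
  unfolding rcis_def cis_mult[symmetric] using cis_multiple_2pi[of "of_int n"] by simp

lemma rcis_in_polar_region:
  "\<lbrakk>r \<le> q; q \<le> s; a \<le> t; t \<le> b\<rbrakk> \<Longrightarrow> rcis q t \<in> polar_region r s a b"
  by (auto simp: polar_region_def)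

lemma rcis_eq_imp:
  assumes "rcis q t = rcis q' t'" "0 < q" "0 < q'"
  shows "q = q'" "\<exists>n::int. t = t' + 2 * pi * n"
proof -
  have "cmod (rcis q t) = cmod (rcis q' t')" using assms by simp
  then show "q = q'" using assms(2,3) by simp
  then have "cis t = cis t'" using assms by (simp add: rcis_def)
  then have "sin t = sin t' \<and> cos t = cos t'" by (simp add: complex_eq_iff)
  then show "\<exists>n::int. t = t' + 2 * pi * n" by (simp add: sin_cos_eq_iff)
qed

lemma circle_eq_circular_arc: "{z. cmod z = q} = circular_arc q (- pi) pi" if "0 < q"
proof -
  have "z \<in> circular_arc (cmod z) (- pi) pi" for z
    using rcis_cmod_Arg[of z] Arg_bounded[of z] unfolding circular_arc_def
    by (auto intro!: exI[of _ "Arg z"] less_imp_le)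
  then show ?thesis using that by (auto simp: circular_arc_def)
qed

lemma present_in_arc:
  assumes "present a b t"
  shows "rcis q t \<in> circular_arc q a b"
proof -
  obtain n :: int where "a + 2 * pi * n \<le> t" "t < b + 2 * pi * n"
    using assms by (auto simp: present_def)
  moreover have "rcis q t = rcis q (t - 2 * pi * n)"
    using rcis_periodic[of q "t - 2 * pi * n" n] by simp
  ultimately show ?thesis
    unfolding circular_arc_def by (auto intro!: exI[of _ "t - 2 * pi * n"])
qed

text \<open>The contained arc has positive length, so it cannot begin at the last point of an arc
  that is not a full circle.\<close>

lemma arc_subset_imp_present:
  assumes sub: "circular_arc q c d \<subseteq> circular_arc r a b"
    and "0 < q" "0 < r" "c < d" "a \<le> b" "b \<le> a + 2 * pi"
  shows "q = r" "present a b c"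
proof -
  have ex: "q = r \<and> (\<exists>n::int. a + 2 * pi * n \<le> t \<and> t \<le> b + 2 * pi * n)" if "c \<le> t" "t \<le> d" for t
  proof -
    have "rcis q t \<in> circular_arc r a b" using sub that by (auto simp: circular_arc_def)
    then obtain t' where t': "rcis q t = rcis r t'" "a \<le> t'" "t' \<le> b"
      by (auto simp: circular_arc_def)
    obtain n :: int where "t = t' + 2 * pi * n" using rcis_eq_imp(2)[OF t'(1) assms(2,3)] by blast
    with t' rcis_eq_imp(1)[OF t'(1) assms(2,3)] show ?thesis by (auto intro!: exI[of _ n])
  qed
  show "q = r" using ex[of c] assms by simp
  show "present a b c"
  proof (rule ccontr)
    assume no: "\<not> present a b c"
    obtain n :: int where n: "a + 2 * pi * n \<le> c" "c \<le> b + 2 * pi * n"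
      using ex[of c] assms by auto
    then have c: "c = b + 2 * pi * n" using no by (force simp: present_def)
    \<comment> \<open>On a full circle the end of one copy is the start of the next.\<close>
    have "b \<noteq> a + 2 * pi"
    proof
      assume "b = a + 2 * pi"
      then have "present a b c" using c unfolding present_def
        by (intro exI[of _ "n + 1"]) (simp add: algebra_simps)
      then show False using no by simp
    qed
    then have less: "c < a + 2 * pi * n + 2 * pi" using assms c by simp
    \<comment> \<open>An angle of the contained arc in the gap between the end of one copy and the
      start of the next.\<close>
    define t where "t = min d ((c + (a + 2 * pi * n + 2 * pi)) / 2)"
    have t: "c < t" "t \<le> d" "t < a + 2 * pi * n + 2 * pi"
      using less assms by (auto simp: t_def min_def)
    then obtain m :: int where m: "a + 2 * pi * m \<le> t" "t \<le> b + 2 * pi * m"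
      using ex[of t] by auto
    show False
    proof (cases "m \<le> n")
      case True
      then have "2 * pi * of_int m \<le> 2 * pi * (of_int n :: real)" by simp
      then show False using m(2) t(1) c by linarith
    next
      case False
      then have "of_int (n + 1) \<le> (of_int m :: real)" by linarith
      then have "2 * pi * of_int (n + 1) \<le> 2 * pi * (of_int m :: real)"
        by (intro mult_left_mono) auto
      then show False using m(1) t(3) by (simp add: algebra_simps)
    qed
  qed
qed

lemma object_is_circular_arc:
  assumes "is_arc A \<or> is_circle A"
  shows "\<exists>r a b. 0 < r \<and> a \<le> b \<and> b \<le> a + 2 * pi \<and> A = circular_arc r a b"
  using assms
proof
  assume "is_arc A"
  then obtain r a b where "0 < r" "0 \<le> b - a" "b - a < 2 * pi" "A = circular_arc r a b"
    by (auto simp: is_arc_def)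
  then show ?thesis by (intro exI[of _ r] exI[of _ a] exI[of _ b]) auto
next
  assume "is_circle A"
  then obtain r where "0 < r" "A = {z. cmod z = r}" by (auto simp: is_circle_def)
  then show ?thesis
    using circle_eq_circular_arc[of r]
    by (intro exI[of _ r] exI[of _ "- pi"] exI[of _ pi]) simp
qed

lemma k_visible_sym: "k_visible k V f u v \<longleftrightarrow> k_visible k V f v u"
  unfolding k_visible_def insert_commute[of u v] by blast

lemma k_visible_remove:
  assumes "finite V" "k_visible k V f u v"
  shows "k_visible k (V - {w}) f u v"
proof -
  from assms(2) obtain C A B where *: "cone C A B" "A \<subseteq> f u \<and> B \<subseteq> f v \<or> A \<subseteq> f v \<and> B \<subseteq> f u"
    "card {x \<in> V - {u, v}. C \<inter> f x \<noteq> {}} \<le> k"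
    unfolding k_visible_def by blast
  have "card {x \<in> V - {w} - {u, v}. C \<inter> f x \<noteq> {}} \<le> card {x \<in> V - {u, v}. C \<inter> f x \<noteq> {}}"
    using assms(1) by (intro card_mono) auto
  with * show ?thesis unfolding k_visible_def by (meson le_trans)
qed

text \<open>The straight side of the cone at its initial angle \<open>c\<close> is enough: both end
  objects are present there, and every object crossing that side meets the cone. For a bow-tie this
  side runs through the origin.\<close>

lemma (in circular_sweep) k_visible_linked:
  assumes f: "\<And>w. w \<in> V \<Longrightarrow> f w = circular_arc (r w) (a w) (b w)"
    and len: "\<And>w. w \<in> V \<Longrightarrow> a w \<le> b w \<and> b w \<le> a w + 2 * pi"
    and "k_visible k V f u v" and V: "u \<in> V" "v \<in> V" and "u \<noteq> v"
  shows "linked u v"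
proof -
  have arc: "q = r w \<and> w \<in> S c" if "circular_arc q c d \<subseteq> f w" "0 < q" "c < d" "w \<in> V" for q c d w
    using arc_subset_imp_present[of q c d "r w" "a w" "b w"] that f len pos by (auto simp: S_def)
  have S: "rcis (r w) t \<in> f w \<and> w \<in> V" if "w \<in> S t" for w t
    using that present_in_arc f by (auto simp: S_def)
  have main: "linked u v" if cone: "cone C A B" "A \<subseteq> f u" "B \<subseteq> f v"
    and card: "card {w \<in> V - {u, v}. C \<inter> f w \<noteq> {}} \<le> k" and V: "u \<in> V" "v \<in> V" "u \<noteq> v" for C A B u v
    using cone(1)
  proof cases
    case (annular q q' c d)
    have u: "q = r u" "u \<in> S c" and v: "q' = r v" "v \<in> S c"
      using arc[of q c d u] arc[of q' c d v] annular cone V by auto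
    have "between r (S c) (S (c + pi)) (r u) (r v) - {u, v} \<subseteq> {w \<in> V - {u, v}. C \<inter> f w \<noteq> {}}"
    proof
      fix w assume w: "w \<in> between r (S c) (S (c + pi)) (r u) (r v) - {u, v}"
      then obtain z where z: "r u < z" "z < r v" "occurs r (S c) (S (c + pi)) w z"
        by (auto simp: between_def)
      then have wS: "w \<in> S c" "r u < r w" "r w < r v"
        using pos[OF V(1)] pos_SL(1)[of w c "c + pi"] by (auto simp: occurs_def)
      then have "rcis (r w) c \<in> C"
        using annular u v by (auto intro: rcis_in_polar_region)
      then show "w \<in> {w \<in> V - {u, v}. C \<inter> f w \<noteq> {}}" using w S[OF wS(1)] by auto
    qed
    then have "card (between r (S c) (S (c + pi)) (r u) (r v) - {u, v}) \<le> k"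
      using finite_V by (intro order_trans[OF card_mono card]) auto
    then have "seesS c u (r u) v (r v)"
      using u v V annular by (auto simp: sees_def occurs_def)
    then show ?thesis using V by (auto simp: linked_def ann_def)
  next
    case (bow_tie q q' c d)
    have u: "q = r u" "u \<in> S c" and v: "q' = r v" "v \<in> S (c + pi)"
      using arc[of q c d u] arc[of q' "c + pi" "d + pi" v] bow_tie cone V by auto
    have "between r (S c) (S (c + pi)) (- r v) (r u) - {u, v} \<subseteq> {w \<in> V - {u, v}. C \<inter> f w \<noteq> {}}"
    proof
      fix w assume w: "w \<in> between r (S c) (S (c + pi)) (- r v) (r u) - {u, v}"
      then obtain z where z: "- r v < z" "z < r u" "occurs r (S c) (S (c + pi)) w z"
        by (auto simp: between_def)
      then have "w \<in> S c \<and> r w < r u \<or> w \<in> S (c + pi) \<and> r w < r v" "0 < r w"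
        using pos_SL(1)[of w c "c + pi"] by (auto simp: occurs_def)
      then have "\<exists>t. w \<in> S t \<and> rcis (r w) t \<in> C"
      proof (elim disjE conjE)
        assume "w \<in> S c" "r w < r u" "0 < r w"
        then have "rcis (r w) c \<in> polar_region 0 q c d"
          using bow_tie u by (intro rcis_in_polar_region) auto
        then show ?thesis using \<open>w \<in> S c\<close> bow_tie by blast
      next
        assume "w \<in> S (c + pi)" "r w < r v" "0 < r w"
        then have "rcis (r w) (c + pi) \<in> polar_region 0 q' (c + pi) (d + pi)"
          using bow_tie v by (intro rcis_in_polar_region) auto
        then show ?thesis using \<open>w \<in> S (c + pi)\<close> bow_tie by blast
      qed
      then show "w \<in> {w \<in> V - {u, v}. C \<inter> f w \<noteq> {}}" using w S by auto
    qed
    then have "card (between r (S c) (S (c + pi)) (- r v) (r u) - {u, v}) \<le> k"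
      using finite_V by (intro order_trans[OF card_mono card]) auto
    \<comment> \<open>Signed distances grow towards the ray of \<open>u\<close>, so \<open>v\<close>
      on the opposite ray comes first.\<close>
    then have "seesS c v (- r v) u (r u)"
      using u v V bow_tie pos[OF V(1)] pos[OF V(2)]
      by (auto simp: sees_def occurs_def insert_commute)
    then show ?thesis using V by (auto simp: linked_def bow_def)
  qed
  obtain C A B where *: "cone C A B" "A \<subseteq> f u \<and> B \<subseteq> f v \<or> A \<subseteq> f v \<and> B \<subseteq> f u"
    "card {w \<in> V - {u, v}. C \<inter> f w \<noteq> {}} \<le> k"
    using assms(3) unfolding k_visible_def by blast
  have "linked u v \<or> linked v u"
    using *(2) main[OF *(1) _ _ *(3) V \<open>u \<noteq> v\<close>] main[OF *(1), of v u] *(3) V \<open>u \<noteq> v\<close>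
    by (auto simp: insert_commute)
  then show ?thesis by (auto simp: linked_def)
qed

section \<open>Low degree and greedy colouring\<close>

lemma ex_few_visible:
  assumes fin: "finite V" and "V \<noteq> {}"
    and obj: "\<And>v. v \<in> V \<Longrightarrow> is_arc (f v) \<or> is_circle (f v)"
    and disj: "pairwise (\<lambda>u v. disjnt (f u) (f v)) V"
  shows "\<exists>v\<in>V. card {u \<in> V - {v}. k_visible k V f v u} < 6 * k + 6"
proof -
  have "\<forall>v. \<exists>r a b. v \<in> V \<longrightarrow> 0 < r \<and> a \<le> b \<and> b \<le> a + 2 * pi \<and> f v = circular_arc r a b"
    using object_is_circular_arc obj by blast
  then obtain r a b where
    f: "\<And>v. v \<in> V \<Longrightarrow> 0 < r v \<and> a v \<le> b v \<and> b v \<le> a v + 2 * pi \<and> f v = circular_arc (r v) (a v) (b v)"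
    by metis
  obtain rank :: "'a \<Rightarrow> nat" where rank: "inj_on rank V"
    "\<And>u v. u \<in> V \<Longrightarrow> v \<in> V \<Longrightarrow> r u < r v \<Longrightarrow> rank u < rank v"
    using ex_rank[OF fin] by blast
  interpret circular_sweep V r a b rank k
  proof
    fix u v t
    assume *: "u \<in> V" "v \<in> V" "r u = r v" "present (a u) (b u) t" "present (a v) (b v) t"
    \<comment> \<open>Two objects of equal radius that are both present at \<open>t\<close> share
      this point.\<close>
    have "rcis (r u) t \<in> f u" "rcis (r u) t \<in> f v"
      using present_in_arc[OF *(4), of "r u"] present_in_arc[OF *(5), of "r v"] * f by auto
    then show "u = v" using disj * by (auto simp: pairwise_def disjnt_def)
  qed (use fin f rank in auto)
  obtain v where v: "v \<in> V" "card {u. linked v u} < 6 * k + 6"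
    using ex_low_degree \<open>V \<noteq> {}\<close> by blast
  have "{u \<in> V - {v}. k_visible k V f v u} \<subseteq> {u. linked v u}"
    using k_visible_linked[of f v] f v(1) by blast
  moreover have "finite {u. linked v u}"
    by (rule finite_subset[OF _ fin]) (auto simp: linked_def)
  ultimately have "card {u \<in> V - {v}. k_visible k V f v u} \<le> card {u. linked v u}"
    by (intro card_mono)
  with v show ?thesis by (intro bexI[of _ v]) auto
qed

text \<open>Induction runs over sets of objects: with fewer blockers visibility only grows, so a
  colouring of \<open>V - {v}\<close> already separates the pairs visible in \<open>V\<close> that
  avoid \<open>v\<close>. The neighbours of \<open>v\<close> leave one of the colours free.\<close>

lemma ex_coloring:
  assumes "finite V" "\<And>v. v \<in> V \<Longrightarrow> is_arc (f v) \<or> is_circle (f v)"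
    and "pairwise (\<lambda>u v. disjnt (f u) (f v)) V"
  shows "\<exists>c :: 'a \<Rightarrow> nat. (\<forall>v\<in>V. c v < 6 * k + 6) \<and>
    (\<forall>u\<in>V. \<forall>v\<in>V. u \<noteq> v \<longrightarrow> k_visible k V f u v \<longrightarrow> c u \<noteq> c v)"
  using assms
proof (induction V rule: finite_psubset_induct)
  case (psubset V)
  show ?case
  proof (cases "V = {}")
    case False
    obtain v where v: "v \<in> V" "card {u \<in> V - {v}. k_visible k V f v u} < 6 * k + 6"
      using ex_few_visible[OF psubset.hyps False psubset.prems] by blast
    let ?N = "{u \<in> V - {v}. k_visible k V f v u}"
    have "pairwise (\<lambda>u v. disjnt (f u) (f v)) (V - {v})"
      using psubset.prems(2) by (rule pairwise_subset) auto
    then obtain c :: "'a \<Rightarrow> nat" where c: "\<forall>w\<in>V - {v}. c w < 6 * k + 6"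
      "\<forall>u\<in>V - {v}. \<forall>w\<in>V - {v}. u \<noteq> w \<longrightarrow> k_visible k (V - {v}) f u w \<longrightarrow> c u \<noteq> c w"
      using psubset.IH[of "V - {v}"] psubset.prems(1) v(1) by auto
    have "card (c ` ?N) < card {..<6 * k + 6}"
      using card_image_le[of ?N c] v(2) psubset.hyps by simp
    then have "\<not> {..<6 * k + 6} \<subseteq> c ` ?N"
      using psubset.hyps card_mono[of "c ` ?N" "{..<6 * k + 6}"] by auto
    then obtain i where i: "i < 6 * k + 6" "i \<notin> c ` ?N" by auto
    show ?thesis
    proof (intro exI[of _ "c(v := i)"] conjI ballI impI)
      fix w assume "w \<in> V"
      then show "(c(v := i)) w < 6 * k + 6" using c(1) i(1) by simp
    next
      fix x y assume *: "x \<in> V" "y \<in> V" "x \<noteq> y" "k_visible k V f x y"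
      then have "k_visible k V f y x" "k_visible k (V - {v}) f x y"
        using k_visible_sym k_visible_remove[OF psubset.hyps] by metis+
      then show "(c(v := i)) x \<noteq> (c(v := i)) y"
        using * c(2) i(2) by auto
    qed
  qed simp
qed

theorem corollary12:
  fixes k :: nat and G :: "('a, 'b) pre_digraph"
  assumes "circle_visibility_graph k G"
  shows "chromatic_number G \<le> 6 * k + 6"
proof -
  interpret graph G using assms by (simp add: circle_visibility_graph_def)
  obtain f where f: "circle_representation k G f"
    using assms by (auto simp: circle_visibility_graph_def)
  then obtain c :: "'a \<Rightarrow> nat" where c: "\<forall>v\<in>verts G. c v < 6 * k + 6"
    "\<forall>u\<in>verts G. \<forall>v\<in>verts G. u \<noteq> v \<longrightarrow> k_visible k (verts G) f u v \<longrightarrow> c u \<noteq> c v"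
    using ex_coloring[OF finite_verts, of f k] by (auto simp: circle_representation_def)
  have "proper_coloring G (6 * k + 6) c"
    unfolding proper_coloring_def
  proof (intro conjI ballI impI)
    fix u v assume "u \<in> verts G" "v \<in> verts G" "u \<rightarrow>\<^bsub>G\<^esub> v"
    moreover from this have "u \<noteq> v" using adj_not_same by blast
    ultimately show "c u \<noteq> c v" using f c(2) unfolding circle_representation_def by blast
  qed (use c in simp)
  then show ?thesis
    unfolding chromatic_number_def by (intro Least_le exI)
qed

end
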